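(* Let $G=(V,E)$ be a connected finite graph in which every vertex carries a loop, with cyclomatic number $k$ (so that a spanning tree is obtained from $G$ by deleting $k$ non-loop edges), and let $T$ be an arbitrary spanning tree of $G$ (with all loops kept). Let $f$ be an optimal opinion function of $T$, and suppose that among the $k$ edges of $G$ deleted to obtain $T$, exactly $s$ join two vertices both having opinion $+1$ under $f$ and the remaining $l$ do not, where $l+s=k$. Then $$\gamma(T)-4k\le \gamma(G)\le \gamma(T)+2l.$$
   Context: All graphs are finite with vertex set $V$, $|V|=n$, and every vertex has a loop. For $v\in V$, the neighborhood $N_v=\{w\in V:(v,w)\in E\}$ contains $v$ itself. An opinion function is a map $f:V\to\{-1,1\}$ (opinion $+1$ is "for", $-1$ is "against"), extended to subsets by $f(W)=\sum_{w\in W}f(w)$. A vertex $v$ votes "for" if $f(N_v)>0$; $V^+=\{v\in V: f(N_v)>0\}$. The opinion function $f$ is strictly majoritarian on the graph if $|V^+|>|V|/2$. The strict domination number is $\gamma(G)=\min\{f(V): f \text{ strictly majoritarian on } G\}$, and an opinion function of a graph is optimal if it is strictly majoritarian on that graph and $f(V)$ equals its strict domination number. The cyclomatic number of a connected graph is (number of non-loop edges) $-|V|+1$. *)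

theory Defs
  imports Complex_Main "HOL-Library.FuncSet" "Graph_Theory.Graph_Theory"
begin

text \<open>
  An undirected graph without parallel edges is a finite symmetric digraph whose arcs are pairs
  of vertices; the undirected edge between \<open>u\<close> and \<open>v\<close> is the pair of arcs
  \<open>(u, v)\<close>, \<open>(v, u)\<close>, and the loop at \<open>v\<close> is the single arc \<open>(v, v)\<close>.
\<close>

locale looped_graph = pair_pseudo_graph +
  assumes loops: "v \<in> pverts G \<Longrightarrow> (v, v) \<in> parcs G"

definition nbhd :: "'a pair_pre_digraph \<Rightarrow> 'a \<Rightarrow> 'a set" where
  "nbhd G v = {w \<in> pverts G. (v, w) \<in> parcs G}"

definition nonloop_edges :: "'a pair_pre_digraph \<Rightarrow> 'a set set" where
  "nonloop_edges G = {{u, v} | u v. (u, v) \<in> parcs G \<and> u \<noteq> v}"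

definition cyclomatic_number :: "'a pair_pre_digraph \<Rightarrow> int" where
  "cyclomatic_number G = int (card (nonloop_edges G)) - int (card (pverts G)) + 1"

text \<open>
  The constants \<^const>\<open>tree\<close> and \<^const>\<open>spanning_tree\<close> forbid all directed cycles, including
  loops and the closed walks \<open>u, v, u\<close> present in every symmetric digraph with an edge.
  In a symmetric digraph without parallel arcs, the cycles of the undirected graph, loops
  disregarded, are exactly the directed cycles with at least three arcs.
\<close>

definition looped_tree :: "'a pair_pre_digraph \<Rightarrow> bool" where
  "looped_tree T \<longleftrightarrow>
     looped_graph T \<and> Digraph_Component.connected (with_proj T) \<and>
     (\<nexists>p. pre_digraph.cycle (with_proj T) p \<and> length p \<ge> 3)"

definition looped_spanning_tree :: "'a pair_pre_digraph \<Rightarrow> 'a pair_pre_digraph \<Rightarrow> bool" where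
  "looped_spanning_tree T G \<longleftrightarrow> looped_tree T \<and> spanning (with_proj T) (with_proj G)"

definition opinion_function :: "'a pair_pre_digraph \<Rightarrow> ('a \<Rightarrow> int) \<Rightarrow> bool" where
  "opinion_function G f \<longleftrightarrow> f \<in> pverts G \<rightarrow> {-1, 1}"

definition votes_for :: "'a pair_pre_digraph \<Rightarrow> ('a \<Rightarrow> int) \<Rightarrow> 'a set" where
  "votes_for G f = {v \<in> pverts G. sum f (nbhd G v) > 0}"

definition strictly_majoritarian :: "'a pair_pre_digraph \<Rightarrow> ('a \<Rightarrow> int) \<Rightarrow> bool" where
  "strictly_majoritarian G f \<longleftrightarrow>
     opinion_function G f \<and> real (card (votes_for G f)) > real (card (pverts G)) / 2"

definition strict_domination_number :: "'a pair_pre_digraph \<Rightarrow> int" where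
  "strict_domination_number G = Min {sum f (pverts G) | f. strictly_majoritarian G f}"

definition optimal_opinion :: "'a pair_pre_digraph \<Rightarrow> ('a \<Rightarrow> int) \<Rightarrow> bool" where
  "optimal_opinion G f \<longleftrightarrow>
     strictly_majoritarian G f \<and> sum f (pverts G) = strict_domination_number G"

text \<open>The minimum in \<^const>\<open>strict_domination_number\<close> is over a finite nonempty set.\<close>

lemma finite_majoritarian_sums:
  assumes "finite (pverts G)"
  shows "finite {sum f (pverts G) | f. strictly_majoritarian G f}"
proof (rule finite_subset)
  show "{sum f (pverts G) | f. strictly_majoritarian G f}
      \<subseteq> {- int (card (pverts G)) .. int (card (pverts G))}"
  proof clarify
    fix f :: "'a \<Rightarrow> int"
    assume "strictly_majoritarian G f"
    have *: "- 1 \<le> f v \<and> f v \<le> 1" if "v \<in> pverts G" for v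
    proof -
      have "f v \<in> {- 1, 1}"
        using \<open>strictly_majoritarian G f\<close> that
        unfolding strictly_majoritarian_def opinion_function_def by blast
      then show ?thesis by auto
    qed
    have "(\<Sum>v\<in>pverts G. - 1) \<le> sum f (pverts G)" "sum f (pverts G) \<le> (\<Sum>v\<in>pverts G. 1)"
      using * by (blast intro: sum_mono)+
    then show "sum f (pverts G) \<in> {- int (card (pverts G)) .. int (card (pverts G))}"
      by simp
  qed
qed simp

lemma (in looped_graph) majoritarian_sums_nonempty:
  assumes "pverts G \<noteq> {}"
  shows "{sum f (pverts G) | f. strictly_majoritarian G f} \<noteq> {}"
proof -
  have "nbhd G v \<noteq> {} \<and> finite (nbhd G v)" if "v \<in> pverts G" for v
    using that loops pair_finite_verts by (auto simp: nbhd_def)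
  then have "votes_for G (\<lambda>_. 1) = pverts G"
    by (auto simp: votes_for_def card_gt_0_iff)
  moreover have "card (pverts G) > 0"
    using assms pair_finite_verts by (simp add: card_gt_0_iff)
  ultimately have "strictly_majoritarian G (\<lambda>_. 1)"
    by (simp add: strictly_majoritarian_def opinion_function_def)
  then show ?thesis by blast
qed

end

theory Submission
  imports Defs
begin

text \<open>
  Both bounds come from changing one edge at a time and turning some \<open>-1\<close> opinions into \<open>+1\<close>
  so that no vertex stops voting ``for''. When an edge with an endpoint of opinion \<open>-1\<close> is added,
  turning one such endpoint costs 2 and decreases no neighbourhood sum; an edge joining two
  vertices of opinion \<open>+1\<close> costs nothing. When an edge is deleted, turning one negative vertex in
  the remaining neighbourhood of each endpoint costs at most 4; an endpoint without such a
  neighbour votes ``for'' anyway, because of its loop. A connected graph on \<open>n\<close> vertices has at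
  least \<open>n - 1\<close> edges, so at most \<open>k\<close> edges are deleted.
\<close>

section \<open>Opinion functions on families of neighbourhoods\<close>

text \<open>Edges are put into a bare neighbourhood function, so that inductions over edges need no
  intermediate graphs. An edge is a two-element set, which serves both endpoints alike.\<close>

definition add_edges :: "('a \<Rightarrow> 'a set) \<Rightarrow> 'a set set \<Rightarrow> 'a \<Rightarrow> 'a set" where
  "add_edges N F v = N v \<union> {w. {v, w} \<in> F}"

lemma add_edges_empty [simp]: "add_edges N {} = N"
  by (simp add: add_edges_def fun_eq_iff)

lemma add_edges_insert_notin: "v \<notin> e \<Longrightarrow> add_edges N (insert e F) v = add_edges N F v"
  by (auto simp: add_edges_def)

lemma add_edges_insert_pair:
  "add_edges N (insert {v, w} F) v = insert w (add_edges N F v)"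
  by (auto simp: add_edges_def doubleton_eq_iff)

lemma sum_int_mono_fun:
  fixes f g :: "'a \<Rightarrow> int"
  shows "f \<le> g \<Longrightarrow> sum f A \<le> sum g A"
  by (intro sum_mono) (simp add: le_fun_def)

lemma sum_flip:
  fixes f :: "'a \<Rightarrow> int"
  assumes "finite A" "f u = -1"
  shows "sum (f(u := 1)) A = sum f A + (if u \<in> A then 2 else 0)"
proof (cases "u \<in> A")
  case True
  have "sum (f(u := 1)) (A - {u}) = sum f (A - {u})"
    by (intro sum.cong) auto
  then show ?thesis
    using assms True by (simp add: sum.remove)
next
  case False
  then have "sum (f(u := 1)) A = sum f A"
    by (intro sum.cong) auto
  with False show ?thesis by simp
qed

text \<open>If some opinion in \<open>A\<close> is -1, flipping one of them adds 2 to both sums.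
  Otherwise \<open>f\<close> is 1 throughout \<open>A\<close>, and its sum there is
  \<open>card A\<close>, positive without any change.\<close>

lemma raise_opinion_on:
  fixes f :: "'a \<Rightarrow> int"
  assumes "finite V" "A \<subseteq> V" "A \<noteq> {}" "f \<in> V \<rightarrow> {-1, 1}"
  obtains g where "g \<in> V \<rightarrow> {-1, 1}" "f \<le> g" "sum g V \<le> sum f V + 2"
    "sum f A \<ge> 0 \<Longrightarrow> sum g A > 0"
proof (cases "\<exists>u\<in>A. f u = -1")
  case True
  then obtain u where "u \<in> A" "f u = -1" by blast
  show ?thesis
  proof (rule that)
    show "f(u := 1) \<in> V \<rightarrow> {-1, 1}" using assms(4) by (simp add: Pi_iff)
    show "f \<le> f(u := 1)" using \<open>f u = -1\<close> by (simp add: le_fun_def)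
    show "sum (f(u := 1)) V \<le> sum f V + 2"
      unfolding sum_flip[where f = f and u = u, OF assms(1) \<open>f u = -1\<close>] by simp
    show "sum (f(u := 1)) A > 0" if "sum f A \<ge> 0"
      using that \<open>u \<in> A\<close>
        sum_flip[where f = f and u = u, OF finite_subset[OF assms(2,1)] \<open>f u = -1\<close>] by simp
  qed
next
  case False
  with assms(2,4) have "f v = 1" if "v \<in> A" for v
    using that by blast
  then have "sum f A = int (card A)" by simp
  moreover have "card A > 0"
    using assms(1-3) by (simp add: card_gt_0_iff finite_subset)
  ultimately show ?thesis
    using that[of f] assms(4) by simp
qed

text \<open>\<open>N\<close> will be the neighbourhoods in the spanning tree and \<open>D\<close>
  the set of deleted edges. \<open>N_refl\<close> records the loops; \<open>D_new\<close> makes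
  every inserted edge contribute a new summand.\<close>

locale extra_edges =
  fixes V :: "'a set" and N :: "'a \<Rightarrow> 'a set" and D :: "'a set set"
  assumes finite_V: "finite V"
    and N_subset: "v \<in> V \<Longrightarrow> N v \<subseteq> V"
    and N_refl: "v \<in> V \<Longrightarrow> v \<in> N v"
    and D_edge: "e \<in> D \<Longrightarrow> \<exists>u w. e = {u, w} \<and> u \<in> V \<and> w \<in> V \<and> u \<noteq> w"
    and D_new: "{v, w} \<in> D \<Longrightarrow> w \<notin> N v"
begin

lemma finite_D: "finite D"
  using D_edge finite_V by (auto intro!: finite_subset[of D "Pow V"])

lemma add_edges_subset: "F \<subseteq> D \<Longrightarrow> v \<in> V \<Longrightarrow> add_edges N F v \<subseteq> V"
  using N_subset D_edge by (fastforce simp: add_edges_def doubleton_eq_iff)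

lemma finite_add_edges: "F \<subseteq> D \<Longrightarrow> v \<in> V \<Longrightarrow> finite (add_edges N F v)"
  using finite_subset[OF add_edges_subset finite_V] .

lemma add_edges_refl: "v \<in> V \<Longrightarrow> v \<in> add_edges N F v"
  using N_refl by (simp add: add_edges_def)

lemma sum_add_edges_insert:
  fixes f :: "'a \<Rightarrow> int"
  assumes "insert {v, w} F \<subseteq> D" "{v, w} \<notin> F" "v \<in> V"
  shows "sum f (add_edges N (insert {v, w} F) v) = f w + sum f (add_edges N F v)"
proof -
  have "w \<notin> add_edges N F v"
    using assms D_new[of v w] by (simp add: add_edges_def)
  then show ?thesis
    using assms finite_add_edges[of F v] by (simp add: add_edges_insert_pair)
qed

section \<open>Adding edges\<close>

text \<open>The flipped endpoint \<open>u\<close> of \<open>e\<close> lies in the new neighbourhood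
  of both endpoints: in its own by the loop, in the other one by \<open>e\<close>. Everywhere else
  \<open>f \<le> g\<close> suffices.\<close>

lemma add_edge_opinion:
  fixes f :: "'a \<Rightarrow> int"
  assumes F: "insert e F \<subseteq> D" "e \<notin> F" and f: "f \<in> V \<rightarrow> {-1, 1}"
  obtains g where "g \<in> V \<rightarrow> {-1, 1}" "f \<le> g"
    "sum g V \<le> sum f V + (if \<forall>v\<in>e. f v = 1 then 0 else 2)"
    "\<And>v. v \<in> V \<Longrightarrow> sum f (add_edges N F v) \<le> sum g (add_edges N (insert e F) v)"
proof (cases "\<forall>v\<in>e. f v = 1")
  case True
  show ?thesis
  proof (rule that[of f])
    fix v assume v: "v \<in> V"
    show "sum f (add_edges N F v) \<le> sum f (add_edges N (insert e F) v)"
    proof (cases "v \<in> e")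
      case True
      then obtain w where e: "e = {v, w}" using D_edge[of e] F by auto
      then show ?thesis
        using sum_add_edges_insert[of v w F f] F v \<open>\<forall>v\<in>e. f v = 1\<close> by simp
    qed (simp add: add_edges_insert_notin)
  qed (use f True in auto)
next
  case False
  obtain u where u: "u \<in> e" "f u = -1"
    using False D_edge[of e] F f by blast
  have uV: "u \<in> V" using u D_edge[of e] F by auto
  let ?g = "f(u := 1)"
  have g: "?g \<in> V \<rightarrow> {-1, 1}" using f by (simp add: Pi_iff)
  have le: "f \<le> ?g" using u by (simp add: le_fun_def)
  show ?thesis
  proof (rule that[OF g le])
    show "sum ?g V \<le> sum f V + (if \<forall>v\<in>e. f v = 1 then 0 else 2)"
      using False u finite_V by (simp only: sum_flip) simp
    fix v assume v: "v \<in> V"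
    show "sum f (add_edges N F v) \<le> sum ?g (add_edges N (insert e F) v)"
    proof (cases "v \<in> e")
      case False
      then show ?thesis
        using sum_int_mono_fun[OF le] by (simp add: add_edges_insert_notin)
    next
      case True
      then obtain w where e: "e = {v, w}" and w: "w \<in> V" "v \<noteq> w"
        using D_edge[of e] F by auto
      have "?g w \<in> {-1, 1}" using g w by blast
      then have gw: "?g w \<ge> -1" by auto
      have eq: "sum ?g (add_edges N (insert e F) v) = ?g w + sum ?g (add_edges N F v)"
        unfolding e using F e v by (intro sum_add_edges_insert) auto
      have fl: "sum ?g (add_edges N F v)
          = sum f (add_edges N F v) + (if u \<in> add_edges N F v then 2 else 0)"
        using F v u by (intro sum_flip finite_add_edges) auto
      show ?thesis
      \<comment> \<open>At \<open>u\<close> itself the loop gains 2, which outweighs a new summand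
        of at least -1. At the other endpoint the new summand is the flipped opinion, now 1.\<close>
      proof (cases "u = v")
        case True
        then show ?thesis using eq fl gw add_edges_refl[OF v, of F] by simp
      next
        case False
        then have "u = w" using u e by simp
        then show ?thesis using eq fl by simp
      qed
    qed
  qed
qed

text \<open>The cost is counted with the initial \<open>f\<close>, although later edges meet an
  already raised opinion. Carrying \<open>f \<le> g\<close> through the induction closes this gap:
  an edge with both opinions 1 under \<open>f\<close> remains free of cost.\<close>

lemma add_edges_opinion:
  fixes f :: "'a \<Rightarrow> int"
  assumes "F \<subseteq> D" and f: "f \<in> V \<rightarrow> {-1, 1}"
  shows "\<exists>g. g \<in> V \<rightarrow> {-1, 1} \<and> f \<le> g
    \<and> sum g V \<le> sum f V + 2 * int (card {e \<in> F. \<not> (\<forall>v\<in>e. f v = 1)})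
    \<and> (\<forall>v\<in>V. sum f (N v) \<le> sum g (add_edges N F v))"
  using finite_subset[OF assms(1) finite_D] assms(1)
proof (induction F rule: finite_induct)
  case empty
  then show ?case using f by auto
next
  case (insert e F)
  then obtain g where g: "g \<in> V \<rightarrow> {-1, 1}" "f \<le> g"
    and gV: "sum g V \<le> sum f V + 2 * int (card {e \<in> F. \<not> (\<forall>v\<in>e. f v = 1)})"
    and gN: "\<forall>v\<in>V. sum f (N v) \<le> sum g (add_edges N F v)"
    by auto
  obtain h where h: "h \<in> V \<rightarrow> {-1, 1}" "g \<le> h"
    and hV: "sum h V \<le> sum g V + (if \<forall>v\<in>e. g v = 1 then 0 else 2)"
    and hN: "\<And>v. v \<in> V \<Longrightarrow> sum g (add_edges N F v) \<le> sum h (add_edges N (insert e F) v)"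
    using add_edge_opinion[OF insert.prems insert.hyps(2) g(1)] by blast
  have "g v = 1" if "f v = 1" "v \<in> V" for v
  proof -
    have "g v \<in> {-1, 1}" using g(1) that by blast
    moreover have "f v \<le> g v" using g(2) by (simp add: le_fun_def)
    ultimately show ?thesis using that by auto
  qed
  moreover have "e \<subseteq> V" using D_edge[of e] insert.prems by auto
  ultimately have good: "\<forall>v\<in>e. g v = 1" if "\<forall>v\<in>e. f v = 1"
    using that by blast
  have "{e' \<in> insert e F. \<not> (\<forall>v\<in>e'. f v = 1)}
      = (if \<forall>v\<in>e. f v = 1 then {} else {e}) \<union> {e \<in> F. \<not> (\<forall>v\<in>e. f v = 1)}"
    by auto
  then have "2 * int (card {e' \<in> insert e F. \<not> (\<forall>v\<in>e'. f v = 1)})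
      = (if \<forall>v\<in>e. f v = 1 then 0 else 2) + 2 * int (card {e \<in> F. \<not> (\<forall>v\<in>e. f v = 1)})"
    using insert.hyps by simp
  moreover have "sum h V \<le> sum g V + (if \<forall>v\<in>e. f v = 1 then 0 else 2)"
    using hV good by (auto split: if_splits)
  ultimately have "sum h V \<le> sum f V + 2 * int (card {e' \<in> insert e F. \<not> (\<forall>v\<in>e'. f v = 1)})"
    using gV by linarith
  moreover have "f \<le> h" using g(2) h(2) by simp
  moreover have "\<forall>v\<in>V. sum f (N v) \<le> sum h (add_edges N (insert e F) v)"
    using gN hN by force
  ultimately show ?case using h(1) by blast
qed

section \<open>Removing edges\<close>

text \<open>Without \<open>e\<close>, an endpoint loses a summand of at most 1, so a positive
  integer sum remains at least 0. This is the premise of \<open>raise_opinion_on\<close>, applied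
  once per endpoint at cost 2 each.\<close>

lemma remove_edge_opinion:
  fixes f :: "'a \<Rightarrow> int"
  assumes F: "insert e F \<subseteq> D" "e \<notin> F" and f: "f \<in> V \<rightarrow> {-1, 1}"
  obtains g where "g \<in> V \<rightarrow> {-1, 1}" "sum g V \<le> sum f V + 4"
    "\<And>v. \<lbrakk>v \<in> V; sum f (add_edges N (insert e F) v) > 0\<rbrakk> \<Longrightarrow> sum g (add_edges N F v) > 0"
proof -
  obtain u w where e: "e = {u, w}" and uw: "u \<in> V" "w \<in> V" "u \<noteq> w"
    using D_edge[of e] F by blast
  have sub: "add_edges N F v \<subseteq> V" "add_edges N F v \<noteq> {}" if "v \<in> V" for v
    using that F add_edges_subset[of F v] add_edges_refl[of v F] by auto
  obtain g where g: "g \<in> V \<rightarrow> {-1, 1}" "f \<le> g" "sum g V \<le> sum f V + 2"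
    and gu: "sum f (add_edges N F u) \<ge> 0 \<Longrightarrow> sum g (add_edges N F u) > 0"
    using raise_opinion_on[OF finite_V sub[OF uw(1)] f] by blast
  \<comment> \<open>The second raise starts from \<open>g\<close>. Since opinions only rise, it
    keeps what was gained at \<open>u\<close>, and the first raise keeps the sum at \<open>w\<close>
    nonnegative.\<close>
  obtain h where h: "h \<in> V \<rightarrow> {-1, 1}" "g \<le> h" "sum h V \<le> sum g V + 2"
    and hw: "sum g (add_edges N F w) \<ge> 0 \<Longrightarrow> sum h (add_edges N F w) > 0"
    using raise_opinion_on[OF finite_V sub[OF uw(2)] g(1)] by blast
  have fg: "sum f A \<le> sum g A" and gh: "sum g A \<le> sum h A" for A
    using g(2) h(2) by (simp_all add: sum_int_mono_fun)
  have "f u \<in> {-1, 1}" "f w \<in> {-1, 1}" using f uw by blast+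
  then have le: "f u \<le> 1" "f w \<le> 1" by auto
  show ?thesis
  proof (rule that[OF h(1)])
    show "sum h V \<le> sum f V + 4" using g(3) h(3) by simp
    fix v assume v: "v \<in> V" and pos: "sum f (add_edges N (insert e F) v) > 0"
    consider "v = u" | "v = w" | "v \<notin> e" using e by blast
    then show "sum h (add_edges N F v) > 0"
    proof cases
      case 1
      then have "sum f (add_edges N F u) \<ge> 0"
        using pos sum_add_edges_insert[of u w F f] F e uw le by simp
      then show ?thesis using 1 gu gh[of "add_edges N F u"] by simp
    next
      case 2
      then have "sum f (add_edges N F w) \<ge> 0"
        using pos sum_add_edges_insert[of w u F f] F e uw le by (simp add: insert_commute)
      then show ?thesis using 2 hw fg[of "add_edges N F w"] by simp
    next
      case 3
      then show ?thesis
        using pos fg[of "add_edges N F v"] gh[of "add_edges N F v"]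
        by (simp add: add_edges_insert_notin)
    qed
  qed
qed

lemma remove_edges_opinion:
  fixes f :: "'a \<Rightarrow> int"
  assumes "F \<subseteq> D" "f \<in> V \<rightarrow> {-1, 1}"
  shows "\<exists>g. g \<in> V \<rightarrow> {-1, 1} \<and> sum g V \<le> sum f V + 4 * int (card F)
    \<and> (\<forall>v\<in>V. sum f (add_edges N F v) > 0 \<longrightarrow> sum g (N v) > 0)"
  using finite_subset[OF assms(1) finite_D] assms
\<comment> \<open>Here \<open>e\<close> is removed first and the rest of \<open>F\<close>
  afterwards, starting from the raised opinion; hence \<open>f\<close> is generalised.\<close>
proof (induction F arbitrary: f rule: finite_induct)
  case empty
  then show ?case by auto
next
  case (insert e F)
  obtain g where g: "g \<in> V \<rightarrow> {-1, 1}" "sum g V \<le> sum f V + 4"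
    and gN: "\<And>v. \<lbrakk>v \<in> V; sum f (add_edges N (insert e F) v) > 0\<rbrakk> \<Longrightarrow> sum g (add_edges N F v) > 0"
    using remove_edge_opinion[OF insert.prems(1) insert.hyps(2) insert.prems(2)] by blast
  obtain h where h: "h \<in> V \<rightarrow> {-1, 1}" "sum h V \<le> sum g V + 4 * int (card F)"
    and hN: "\<forall>v\<in>V. sum g (add_edges N F v) > 0 \<longrightarrow> sum h (N v) > 0"
    using insert.IH[of g] insert.prems(1) g(1) by auto
  have "sum h V \<le> sum f V + 4 * int (card (insert e F))"
    using h(2) g(2) insert.hyps by simp
  then show ?case using h(1) hN gN by blast
qed

end

section \<open>Looped graphs\<close>

text \<open>A set that no arc enters or leaves is closed under steps of the symmetric closure, so it
  would contain everything reachable from any of its vertices.\<close>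

lemma arc_leaving_set:
  assumes "Digraph_Component.connected (with_proj G)" "S \<subseteq> pverts G" "S \<noteq> {}" "S \<noteq> pverts G"
  shows "\<exists>u\<in>S. \<exists>v\<in>pverts G - S. (u, v) \<in> parcs G \<or> (v, u) \<in> parcs G"
proof (rule ccontr)
  assume no_arc: "\<not> ?thesis"
  have closed: "v \<in> S" if "u \<in> S" "v \<in> pverts G" "(u, v) \<in> parcs (mk_symmetric (with_proj G))"
    for u v
    using no_arc that by (fastforce simp: parcs_mk_symmetric)
  obtain a b where ab: "a \<in> S" "b \<in> pverts G - S" using assms by blast
  then have "(a, b) \<in> rtrancl_on (pverts G) (parcs (mk_symmetric (with_proj G)))"
    using assms(1,2)
    by (auto simp: Digraph_Component.connected_def strongly_connected_def reachable_def)
  then have "b \<in> S"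
    using ab(1) closed by (induction rule: rtrancl_on_induct) auto
  with ab show False by blast
qed

lemma finite_nonloop_edges: "looped_graph G \<Longrightarrow> finite (nonloop_edges G)"
proof -
  assume "looped_graph G"
  then interpret looped_graph G .
  have "nonloop_edges G \<subseteq> (\<lambda>(u, v). {u, v}) ` parcs G"
    by (auto simp: nonloop_edges_def)
  then show ?thesis using pair_finite_arcs finite_surj by blast
qed

lemma connected_card_nonloop_edges:
  assumes "looped_graph G" "Digraph_Component.connected (with_proj G)"
  shows "card (pverts G) \<le> card (nonloop_edges G) + 1"
proof -
  interpret looped_graph G by fact
  \<comment> \<open>A vertex set is grown one vertex at a time along an arc leaving it. Each step
    brings an edge that was not inside the old set, since its end \<open>v\<close> was
    outside.\<close>
  have grow: "\<exists>S \<subseteq> pverts G. card S = Suc m \<and> m \<le> card {e \<in> nonloop_edges G. e \<subseteq> S}"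
    if "Suc m \<le> card (pverts G)" for m
    using that
  proof (induction m)
    case 0
    then obtain x where "x \<in> pverts G" by (auto simp: Suc_le_eq card_gt_0_iff)
    then show ?case by (intro exI[of _ "{x}"]) simp
  next
    case (Suc m)
    then obtain S where S: "S \<subseteq> pverts G" "card S = Suc m"
      and m: "m \<le> card {e \<in> nonloop_edges G. e \<subseteq> S}" by auto
    have "S \<noteq> {}" "S \<noteq> pverts G" using S Suc.prems by auto
    then obtain u v where uv: "u \<in> S" "v \<in> pverts G - S" "(u, v) \<in> parcs G \<or> (v, u) \<in> parcs G"
      using arc_leaving_set[OF assms(2) S(1)] by blast
    then have "{u, v} \<in> nonloop_edges G"
      by (auto simp: nonloop_edges_def)
    then have sub: "insert {u, v} {e \<in> nonloop_edges G. e \<subseteq> S}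
        \<subseteq> {e \<in> nonloop_edges G. e \<subseteq> insert v S}"
      using uv by auto
    have fin: "finite {e \<in> nonloop_edges G. e \<subseteq> A}" for A
      using finite_nonloop_edges[OF assms(1)] by simp
    have "Suc m \<le> card (insert {u, v} {e \<in> nonloop_edges G. e \<subseteq> S})"
      using uv m fin[of S] by simp
    also have "\<dots> \<le> card {e \<in> nonloop_edges G. e \<subseteq> insert v S}"
      by (rule card_mono[OF fin sub])
    finally have "Suc m \<le> card {e \<in> nonloop_edges G. e \<subseteq> insert v S}" .
    moreover have "card (insert v S) = Suc (Suc m)"
      using S uv finite_subset[OF S(1) pair_finite_verts] by simp
    moreover have "insert v S \<subseteq> pverts G" using S uv by simp
    ultimately show ?case by blast
  qed
  show ?thesis
  proof (cases "card (pverts G)")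
    case (Suc m)
    then obtain S where "m \<le> card {e \<in> nonloop_edges G. e \<subseteq> S}"
      using grow[of m] by auto
    also have "\<dots> \<le> card (nonloop_edges G)"
      using finite_nonloop_edges[OF assms(1)] by (intro card_mono) auto
    finally show ?thesis using Suc by simp
  qed simp
qed

section \<open>Neighbourhoods and the strict domination number\<close>

text \<open>The loop gives \<open>w = v\<close>, and symmetry of the arcs lets an unordered edge be
  read from either end. Neighbourhoods in different graphs can thus be compared through
  \<open>nonloop_edges\<close>.\<close>

lemma in_nbhd_iff:
  assumes "looped_graph G" "v \<in> pverts G"
  shows "w \<in> nbhd G v \<longleftrightarrow> w = v \<or> {v, w} \<in> nonloop_edges G"
proof -
  interpret looped_graph G by fact
  have "(v, w) \<in> parcs G" if "(w, v) \<in> parcs G"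
    using that pair_sym_arcs by (auto simp: symmetric_def dest: symD)
  then show ?thesis
    using assms(2) loops in_arcsD2
    by (auto simp: nbhd_def nonloop_edges_def doubleton_eq_iff)
qed

lemma strict_domination_number_le:
  assumes "looped_graph G" "strictly_majoritarian G f"
  shows "strict_domination_number G \<le> sum f (pverts G)"
  unfolding strict_domination_number_def
  using assms finite_majoritarian_sums pair_fin_digraph.pair_finite_verts
  by (intro Min_le)
    (auto simp: looped_graph_def pair_pseudo_graph_def)

lemma optimal_opinion_exists:
  assumes "looped_graph G" "pverts G \<noteq> {}"
  obtains f where "optimal_opinion G f"
proof -
  interpret looped_graph G by fact
  have "strict_domination_number G \<in> {sum f (pverts G) | f. strictly_majoritarian G f}"
    unfolding strict_domination_number_def
    using finite_majoritarian_sums[OF pair_finite_verts] majoritarian_sums_nonempty[OF assms(2)]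
    by (rule Min_in)
  then show ?thesis using that by (auto simp: optimal_opinion_def)
qed

text \<open>The set of vertices voting for can only grow. This is used from the tree to the graph
  for the upper bound and in reverse for the lower one.\<close>

lemma strictly_majoritarian_transfer:
  assumes "strictly_majoritarian G f" "finite (pverts G)" "pverts H = pverts G"
    and "g \<in> pverts G \<rightarrow> {-1, 1}"
    and "\<And>v. \<lbrakk>v \<in> pverts G; sum f (nbhd G v) > 0\<rbrakk> \<Longrightarrow> sum g (nbhd H v) > 0"
  shows "strictly_majoritarian H g"
proof -
  have "card (votes_for G f) \<le> card (votes_for H g)"
    using assms by (intro card_mono) (auto simp: votes_for_def)
  then show ?thesis
    using assms by (auto simp: strictly_majoritarian_def opinion_function_def)
qed

theorem theorem1:
  fixes G T :: "'a pair_pre_digraph" and f :: "'a \<Rightarrow> int" and k :: int and s l :: nat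
  assumes "looped_graph G"
    and "Digraph_Component.connected (with_proj G)"
    and "k = cyclomatic_number G"
    and "looped_spanning_tree T G"
    and "optimal_opinion T f"
    and "s = card {e \<in> nonloop_edges G - nonloop_edges T. \<forall>v\<in>e. f v = 1}"
    and "l = card {e \<in> nonloop_edges G - nonloop_edges T. \<not> (\<forall>v\<in>e. f v = 1)}"
  shows "strict_domination_number T - 4 * k \<le> strict_domination_number G
       \<and> strict_domination_number G \<le> strict_domination_number T + 2 * int l"
proof -
  interpret G: looped_graph G by fact
  have T: "looped_graph T" "Digraph_Component.connected (with_proj T)"
    and V: "pverts T = pverts G" and arcs: "parcs T \<subseteq> parcs G"
    using assms(4)
    by (auto simp: looped_spanning_tree_def looped_tree_def spanning_def subgraph_def)
  have ET: "nonloop_edges T \<subseteq> nonloop_edges G"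
    using arcs by (auto simp: nonloop_edges_def)
  define D where "D = nonloop_edges G - nonloop_edges T"
  interpret extra_edges "pverts G" "nbhd T" D
  proof
    show "nbhd T v \<subseteq> pverts G" for v by (auto simp: nbhd_def V)
    show "v \<in> nbhd T v" if "v \<in> pverts G" for v
      using that in_nbhd_iff[OF T(1)] V by simp
    show D_edge: "\<exists>u w. e = {u, w} \<and> u \<in> pverts G \<and> w \<in> pverts G \<and> u \<noteq> w" if "e \<in> D" for e
      using that G.in_arcsD1 G.in_arcsD2 unfolding D_def nonloop_edges_def by blast
    show "w \<notin> nbhd T v" if "{v, w} \<in> D" for v w
    proof -
      \<comment> \<open>A vertex can be its own neighbour by its loop, so
        \<open>w \<noteq> v\<close> is needed besides the edge being absent from
        \<open>T\<close>.\<close>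
      have "v \<in> pverts G" "w \<noteq> v"
        using D_edge[OF that] by (auto simp: doubleton_eq_iff)
      then show ?thesis using that in_nbhd_iff[OF T(1)] V by (simp add: D_def)
    qed
  qed (rule G.pair_finite_verts)
  have nbhd_G: "nbhd G v = add_edges (nbhd T) D v" if "v \<in> pverts G" for v
    using that ET V
    by (auto simp: add_edges_def D_def in_nbhd_iff[OF assms(1)] in_nbhd_iff[OF T(1)])
  have nonempty: "pverts G \<noteq> {}"
    using assms(2) by (simp add: Digraph_Component.connected_def strongly_connected_def)
  have f: "strictly_majoritarian T f" "sum f (pverts G) = strict_domination_number T"
    using assms(5) V by (simp_all add: optimal_opinion_def)
  then have "f \<in> pverts G \<rightarrow> {-1, 1}"
    by (simp add: strictly_majoritarian_def opinion_function_def V)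
  \<comment> \<open>Upper bound: all of \<open>D\<close> is added to \<open>T\<close>, starting from
    the given optimal \<open>f\<close>; the edges that cost 2 are those counted by
    \<open>l\<close>.\<close>
  then obtain g where g: "g \<in> pverts G \<rightarrow> {-1, 1}"
    "sum g (pverts G) \<le> sum f (pverts G) + 2 * int l"
    "\<forall>v\<in>pverts G. sum f (nbhd T v) \<le> sum g (add_edges (nbhd T) D v)"
    using add_edges_opinion[of D f] by (auto simp: assms(7) D_def)
  have "strictly_majoritarian G g"
  proof (rule strictly_majoritarian_transfer[OF f(1)])
    show "sum g (nbhd G v) > 0" if "v \<in> pverts T" "sum f (nbhd T v) > 0" for v
      using that g(3) V nbhd_G by fastforce
  qed (use V g(1) G.pair_finite_verts in auto)
  then have upper: "strict_domination_number G \<le> strict_domination_number T + 2 * int l"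
    using strict_domination_number_le[OF assms(1)] f(2) g(2) by fastforce
  \<comment> \<open>Lower bound: all of \<open>D\<close> is removed from \<open>G\<close>, starting
    from an optimal opinion of \<open>G\<close>.\<close>
  obtain p where "optimal_opinion G p"
    using optimal_opinion_exists[OF assms(1) nonempty] .
  then have p: "strictly_majoritarian G p" "sum p (pverts G) = strict_domination_number G"
    by (simp_all add: optimal_opinion_def)
  then have "p \<in> pverts G \<rightarrow> {-1, 1}"
    by (simp add: strictly_majoritarian_def opinion_function_def)
  then obtain q where q: "q \<in> pverts G \<rightarrow> {-1, 1}"
    "sum q (pverts G) \<le> sum p (pverts G) + 4 * int (card D)"
    "\<forall>v\<in>pverts G. sum p (add_edges (nbhd T) D v) > 0 \<longrightarrow> sum q (nbhd T v) > 0"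
    using remove_edges_opinion[of D p] by auto
  have "strictly_majoritarian T q"
    using p(1) G.pair_finite_verts V q(1)
    by (rule strictly_majoritarian_transfer) (use q(3) nbhd_G in auto)
  then have "strict_domination_number T \<le> strict_domination_number G + 4 * int (card D)"
    using strict_domination_number_le[OF T(1)] p(2) q(2) V by fastforce
  moreover have "int (card D) \<le> k"
  proof -
    have "card D = card (nonloop_edges G) - card (nonloop_edges T)"
      unfolding D_def using ET finite_nonloop_edges[OF T(1)] by (rule card_Diff_subset[rotated])
    \<comment> \<open>\<open>T\<close> is connected on the same vertices and so has at least n - 1
      edges. \<open>card_mono\<close> ensures that the difference of natural numbers is not
      truncated.\<close>
    then show ?thesis
      using connected_card_nonloop_edges[OF T] card_mono[OF finite_nonloop_edges[OF assms(1)] ET] V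
      by (simp add: assms(3) cyclomatic_number_def)
  qed
  ultimately show ?thesis using upper by simp
qed

end
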